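(* Let $\epsilon_{0},\ldots,\epsilon_{k}\geq 0$ and $\epsilon=\sum_{i=0}^{k}\epsilon_i$. Let $M_0,\ldots,M_{k}$ be symmetric real $n\times n$ matrices such that $L_{i}=I-M_{i}$ is positive semidefinite for all $i\in\{0,\ldots,k\}$, $L_{i}\approx_{\epsilon_{i-1}}I-M_{i-1}^2$ for all $1\leq i\leq k$, and $L_{k}\approx_{\epsilon_k}I-J$. Then \[ L_{0}^{+}\approx_{\epsilon}\frac{1}{2}(I-J)+\left(\sum_{i=0}^{k-1}\frac{1}{2^{i+2}}W_{i}\right)+\frac{1}{2^{k+1}}W_{k}, \] where for all $i\in \{0,\ldots,k\}$ \[ W_i=(I+M_0)\cdots(I+M_{i-1})(I+M_{i})(I-J)(I+M_{i})(I+M_{i-1})\cdots(I+M_0). \]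
   Context: $J$ is the $n\times n$ matrix with every entry equal to $1/n$; $X^{+}$ is the Moore–Penrose pseudoinverse. For symmetric real matrices $X,Y$, $X\preceq Y$ means $Y-X$ is positive semidefinite, and $X\approx_{\epsilon}Y$ means $e^{-\epsilon}X\preceq Y\preceq e^{\epsilon}X$.
   Formalization: The claim is false as stated; two hypotheses are added: M_0 fixes the all-ones vector (fails for k=1, ε=0, M_0=-J, M_1=J), and I+M_0 is positive semidefinite (fails for k=0, ε_0=ln 10, M_0=I-10(I-J), n=2; automatic if k≥1). *)

theory Defs
  imports "HOL-Analysis.Analysis"
begin

definition J_mat :: "real ^ 'n ^ 'n" where
  "J_mat = (\<chi> i j. 1 / real CARD('n))"

definition symmetric_mat :: "real ^ 'n ^ 'n \<Rightarrow> bool" where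
  "symmetric_mat X \<longleftrightarrow> transpose X = X"

definition psd :: "real ^ 'n ^ 'n \<Rightarrow> bool" where
  "psd X \<longleftrightarrow> symmetric_mat X \<and> (\<forall>x. 0 \<le> x \<bullet> (X *v x))"

definition loewner_le :: "real ^ 'n ^ 'n \<Rightarrow> real ^ 'n ^ 'n \<Rightarrow> bool" where
  "loewner_le X Y \<longleftrightarrow> psd (Y - X)"

definition approx_mat :: "real \<Rightarrow> real ^ 'n ^ 'n \<Rightarrow> real ^ 'n ^ 'n \<Rightarrow> bool" where
  "approx_mat \<epsilon> X Y \<longleftrightarrow> loewner_le (exp (- \<epsilon>) *\<^sub>R X) Y \<and> loewner_le Y (exp \<epsilon> *\<^sub>R X)"

text \<open>The Penrose equations, with transpose as adjoint since the entries are real.  Every real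
  matrix has exactly one solution \<open>Y\<close>, the Moore--Penrose pseudoinverse, and \<open>pinv\<close> selects it.\<close>

definition is_pinv :: "real ^ 'n ^ 'n \<Rightarrow> real ^ 'n ^ 'n \<Rightarrow> bool" where
  "is_pinv X Y \<longleftrightarrow>
     X ** Y ** X = X \<and> Y ** X ** Y = Y \<and>
     transpose (X ** Y) = X ** Y \<and> transpose (Y ** X) = Y ** X"

definition pinv :: "real ^ 'n ^ 'n \<Rightarrow> real ^ 'n ^ 'n" where
  "pinv X = (THE Y. is_pinv X Y)"

lemma is_pinv_unique:
  assumes "is_pinv X Y" "is_pinv X Z"
  shows "Y = Z"
proof -
  have "X ** Y = X ** Z"
  proof -
    have "X ** Y = (X ** Z) ** (X ** Y)"
      using assms by (simp add: is_pinv_def matrix_mul_assoc)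
    also have "\<dots> = transpose ((X ** Y) ** (X ** Z))"
      using assms by (simp add: is_pinv_def matrix_transpose_mul)
    also have "(X ** Y) ** (X ** Z) = X ** Z"
      using assms by (simp add: is_pinv_def matrix_mul_assoc)
    finally show ?thesis using assms by (simp add: is_pinv_def)
  qed
  moreover have "Y ** X = Z ** X"
  proof -
    have "Y ** X = (Y ** X) ** (Z ** X)"
      using assms by (metis is_pinv_def matrix_mul_assoc)
    also have "\<dots> = transpose ((Z ** X) ** (Y ** X))"
      using assms by (simp add: is_pinv_def matrix_transpose_mul)
    also have "(Z ** X) ** (Y ** X) = Z ** X"
      using assms by (metis is_pinv_def matrix_mul_assoc)
    finally show ?thesis using assms by (simp add: is_pinv_def)
  qed
  ultimately show ?thesis
    using assms by (metis is_pinv_def matrix_mul_assoc)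
qed

lemma pinv_eqI: "is_pinv X Y \<Longrightarrow> pinv X = Y"
  unfolding pinv_def using is_pinv_unique by blast

text \<open>\<open>left_prod M i\<close> is \<open>(I + M 0) \<cdots> (I + M i)\<close> and
  \<open>right_prod M i\<close> is \<open>(I + M i) \<cdots> (I + M 0)\<close>; in HOL-Analysis the identity matrix \<open>I\<close> is
  \<open>mat 1\<close>, not \<open>1\<close>.\<close>

primrec left_prod :: "(nat \<Rightarrow> real ^ 'n ^ 'n) \<Rightarrow> nat \<Rightarrow> real ^ 'n ^ 'n" where
  "left_prod M 0 = mat 1 + M 0"
| "left_prod M (Suc i) = left_prod M i ** (mat 1 + M (Suc i))"

primrec right_prod :: "(nat \<Rightarrow> real ^ 'n ^ 'n) \<Rightarrow> nat \<Rightarrow> real ^ 'n ^ 'n" where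
  "right_prod M 0 = mat 1 + M 0"
| "right_prod M (Suc i) = (mat 1 + M (Suc i)) ** right_prod M i"

definition W_mat :: "(nat \<Rightarrow> real ^ 'n ^ 'n) \<Rightarrow> nat \<Rightarrow> real ^ 'n ^ 'n" where
  "W_mat M i = left_prod M i ** (mat 1 - J_mat) ** right_prod M i"

text \<open>The theorem assumes that \<open>M 0\<close> fixes the all-ones vector and that \<open>I + M 0\<close> is positive
  semidefinite, as is the case for the random walk matrix of a regular undirected graph.  The
  conclusion can fail if either assumption is dropped.  For \<open>k = 0\<close> the first one is implied by the other
  hypotheses; for \<open>k \<ge> 1\<close> the second one is.  The next two lemmas give a counterexample for each:
  all remaining hypotheses hold, and the conclusion does not.\<close>

context
begin

private lemmas entrywise = psd_def loewner_le_def symmetric_mat_def approx_mat_def J_mat_def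
  vec_eq_iff matrix_matrix_mult_def matrix_vector_mult_def transpose_def mat_def
  inner_vec_def is_pinv_def sum_2

private lemma psd_I_minus_J: "psd (mat 1 - J_mat :: real ^ 2 ^ 2)"
proof -
  have "0 \<le> x * (x / 2 - y / 2) + y * (y / 2 - x / 2)" for x y :: real
  proof -
    have "x * (x / 2 - y / 2) + y * (y / 2 - x / 2) = (x - y)\<^sup>2 / 2"
      by (simp add: field_simps power2_eq_square)
    then show ?thesis by (simp only:) simp
  qed
  then show ?thesis by (auto simp: entrywise forall_2 algebra_simps)
qed

private lemma psd_I_plus_J: "psd (mat 1 + J_mat :: real ^ 2 ^ 2)"
proof -
  have "0 \<le> x * y + (x * (x * 3) / 2 + 3 * (y * y) / 2)" for x y :: real
  proof -
    have "x * y + (x * (x * 3) / 2 + 3 * (y * y) / 2) = (x + y)\<^sup>2 / 2 + x\<^sup>2 + y\<^sup>2"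
      by (simp add: field_simps power2_eq_square)
    then show ?thesis by (simp only:) simp
  qed
  note nonneg = this
  show ?thesis by (auto simp: entrywise forall_2 algebra_simps nonneg)
qed

lemma counterexample_ones_not_fixed:
  fixes M :: "nat \<Rightarrow> real ^ 2 ^ 2"
  assumes M: "M 0 = - J_mat" "M 1 = J_mat"
  shows "symmetric_mat (M 0)" "symmetric_mat (M 1)"
    "psd (mat 1 - M 0)" "psd (mat 1 - M 1)"
    "approx_mat 0 (mat 1 - M 1) (mat 1 - M 0 ** M 0)"
    "approx_mat 0 (mat 1 - M 1) (mat 1 - J_mat)"
    "psd (mat 1 + M 0)"
    "\<not> approx_mat (0 + 0) (pinv (mat 1 - M 0))
         ((1 / 2) *\<^sub>R (mat 1 - J_mat) + (\<Sum>i<1. (1 / 2 ^ (i + 2)) *\<^sub>R W_mat M i)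
          + (1 / 2 ^ (1 + 1)) *\<^sub>R W_mat M 1)" (is "\<not> approx_mat _ _ ?R")
proof -
  note M = M M(2)[unfolded One_nat_def]
  show "symmetric_mat (M 0)" "symmetric_mat (M 1)"
    by (auto simp: entrywise M)
  show "psd (mat 1 - M 0)" "psd (mat 1 - M 1)" "psd (mat 1 + M 0)"
    using psd_I_minus_J psd_I_plus_J by (simp_all add: M)
  have "psd (0 :: real ^ 2 ^ 2)" "(- J_mat) ** (- J_mat) = (J_mat :: real ^ 2 ^ 2)"
    by (auto simp: entrywise)
  then show "approx_mat 0 (mat 1 - M 1) (mat 1 - M 0 ** M 0)"
    "approx_mat 0 (mat 1 - M 1) (mat 1 - J_mat)"
    by (simp_all add: M approx_mat_def loewner_le_def)
  have "pinv (mat 1 - M 0) = mat 1 - (1 / 2) *\<^sub>R J_mat"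
    by (rule pinv_eqI) (auto simp: M entrywise forall_2)
  moreover have "?R *v 1 = 0"
    by (simp add: W_mat_def M) (simp add: entrywise forall_2)
  ultimately have "1 \<bullet> ((?R - pinv (mat 1 - M 0)) *v 1) < 0"
    by (simp only: matrix_vector_mult_diff_rdistrib) (simp add: entrywise)
  then show "\<not> approx_mat (0 + 0) (pinv (mat 1 - M 0)) ?R"
    by (auto simp: approx_mat_def loewner_le_def psd_def not_le intro!: exI[of _ 1])
qed

lemma counterexample_not_contraction:
  fixes M :: "nat \<Rightarrow> real ^ 2 ^ 2"
  assumes M: "M 0 = mat 1 - 10 *\<^sub>R (mat 1 - J_mat)"
  shows "symmetric_mat (M 0)" "psd (mat 1 - M 0)"
    "approx_mat (ln 10) (mat 1 - M 0) (mat 1 - J_mat)"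
    "M 0 *v (\<chi> i. 1) = (\<chi> i. 1)"
    "\<not> approx_mat (ln 10) (pinv (mat 1 - M 0))
         ((1 / 2) *\<^sub>R (mat 1 - J_mat) + (\<Sum>i<0. (1 / 2 ^ (i + 2)) *\<^sub>R W_mat M i)
          + (1 / 2 ^ (0 + 1)) *\<^sub>R W_mat M 0)" (is "\<not> approx_mat _ _ ?R")
proof -
  define P :: "real ^ 2 ^ 2" where "P = mat 1 - J_mat"
  have s: "psd (c *\<^sub>R P)" if "c \<ge> 0" for c
    using psd_I_minus_J that
    by (auto simp: P_def psd_def symmetric_mat_def scaleR_matrix_vector_assoc [symmetric]
        transpose_def vec_eq_iff)
  have "P - (inverse 10 * 10) *\<^sub>R P = 0" "10 *\<^sub>R 10 *\<^sub>R P - P = 99 *\<^sub>R P"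
    by (auto simp: vec_eq_iff)
  moreover have "psd (0 :: real ^ 2 ^ 2)" using s[of 0] by simp
  ultimately show "psd (mat 1 - M 0)" "approx_mat (ln 10) (mat 1 - M 0) (mat 1 - J_mat)"
    using s[of 10] s[of 99]
    by (simp_all add: M approx_mat_def loewner_le_def exp_minus flip: P_def)
  show "symmetric_mat (M 0)" by (auto simp: entrywise M)
  show "M 0 *v (\<chi> i. 1) = (\<chi> i. 1)" by (simp add: M entrywise forall_2)
  have pinv: "pinv (mat 1 - M 0) = (1 / 10) *\<^sub>R P"
    by (rule pinv_eqI) (simp add: M entrywise forall_2 P_def)
  have R: "?R = (65 / 2) *\<^sub>R P"
    by (simp add: W_mat_def M entrywise forall_2 P_def)
  have "10 *\<^sub>R (1 / 10) *\<^sub>R P - (65 / 2) *\<^sub>R P = (- 63 / 2) *\<^sub>R P"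
    by (simp add: vec_eq_iff)
  moreover have "\<not> psd ((- 63 / 2) *\<^sub>R P)"
    by (auto simp: entrywise P_def axis_def intro!: exI[of _ "axis 1 1"])
  ultimately show "\<not> approx_mat (ln 10) (pinv (mat 1 - M 0)) ?R"
    unfolding pinv R approx_mat_def loewner_le_def by simp
qed

end

end

theory Submission
  imports Defs
begin

text \<open>
  Put \<open>N i = M i - J\<close>.  Since every \<open>M i\<close> fixes the all-ones vector, \<open>I - N i\<close> is positive definite,
  and each quantity of the theorem is its analogue for \<open>N\<close> minus \<open>J\<close>.  With \<open>L = I - N 0\<close> and
  \<open>A = I - (N 0)\<^sup>2\<close> one has \<open>L\<^sup>-\<^sup>1 = (I + (I + N 0) A\<^sup>-\<^sup>1 (I + N 0)) / 2\<close>; as \<open>A\<close> is close to \<open>I - N 1\<close>,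
  inversion is antitone and conjugation is monotone, an induction on \<open>k\<close> applies to the shifted sequence.
  Inverses are avoided by evaluating the forms at \<open>v = L w\<close>, where \<open>v \<bullet> L\<^sup>-\<^sup>1 v = w \<bullet> L w\<close>.

  At the last level, \<open>X = I - N k\<close> has to be compared with \<open>f x = (1 + (2 - x)\<^sup>2) / 2\<close> in place of \<open>1 / x\<close>.
  The lower bound is unconditional, while \<open>f x \<le> 1 / x\<close> holds only for \<open>x \<le> 2\<close>.  If \<open>X\<close> has
  a larger eigenvalue, then \<open>k \<ge> 1\<close> and both of the last two error factors exceed \<open>2\<close>, and \<open>f X\<close> is
  bounded directly against the inverse of \<open>I - (N (k - 1))\<^sup>2\<close>.
\<close>

subsection \<open>Quadratic forms of self-adjoint operators\<close>

definition self_adjoint :: "('a::real_inner \<Rightarrow> 'a) \<Rightarrow> bool" where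
  "self_adjoint X \<longleftrightarrow> linear X \<and> (\<forall>x y. x \<bullet> X y = X x \<bullet> y)"

lemma self_adjoint_linear: "self_adjoint X \<Longrightarrow> linear X"
  by (simp add: self_adjoint_def)

lemma self_adjoint_inner: "self_adjoint X \<Longrightarrow> x \<bullet> X y = X x \<bullet> y"
  by (simp add: self_adjoint_def)

lemmas self_adjoint_expand = self_adjoint_inner linear_diff[OF self_adjoint_linear]
  linear_add[OF self_adjoint_linear] linear_scale[OF self_adjoint_linear]

lemma self_adjoint_id_minus: "self_adjoint X \<Longrightarrow> self_adjoint (\<lambda>x. x - X x)"
  by (auto simp: self_adjoint_def linear_compose_sub linear_id[unfolded id_def] inner_diff_left inner_diff_right)

lemma self_adjoint_compose_self: "self_adjoint X \<Longrightarrow> self_adjoint (\<lambda>x. X (X x))"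
  using linear_compose[of X X] by (auto simp: self_adjoint_def comp_def)

text \<open>The spectral theorem is avoided: \<open>x^2 <= b x\<close> on \<open>[0, b]\<close>
  comes from combining \<open>x (x - b)^2 >= 0\<close> with \<open>x^3 <= b x^2\<close>, each a
  hypothesis at a suitable test vector.\<close>

lemma norm_image_le_form:
  assumes X: "self_adjoint X" and pos: "\<And>x. 0 \<le> x \<bullet> X x"
    and le: "\<And>x. x \<bullet> X x \<le> b * (x \<bullet> x)" and b: "b > 0"
  shows "X z \<bullet> X z \<le> b * (z \<bullet> X z)"
proof -
  have "X z \<bullet> X (X z) \<le> b * (X z \<bullet> X z)" by (rule le)
  moreover have "0 \<le> (X z - b *\<^sub>R z) \<bullet> X (X z - b *\<^sub>R z)" by (rule pos)
  ultimately have "b * (X z \<bullet> X z) \<le> b * (b * (z \<bullet> X z))"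
    by (simp add: self_adjoint_expand[OF X] inner_simps algebra_simps)
  with b show ?thesis by simp
qed

text \<open>\<open>x^2 - E x = (x - E)^2 + E (x - E)\<close>: a square plus a multiple of the
  hypothesis.\<close>

lemma form_le_norm_image:
  assumes X: "self_adjoint X" and ge: "\<And>x. E * (x \<bullet> x) \<le> x \<bullet> X x" and E: "E \<ge> 0"
  shows "E * (z \<bullet> X z) \<le> X z \<bullet> X z"
proof -
  have "E * (E * (z \<bullet> z)) \<le> E * (z \<bullet> X z)" using ge E by (intro mult_left_mono)
  moreover have "0 \<le> (X z - E *\<^sub>R z) \<bullet> (X z - E *\<^sub>R z)" by simp
  ultimately show ?thesis
    by (simp add: self_adjoint_expand[OF X] inner_simps algebra_simps)
qed

section \<open>Comparison of \<open>f\<close> with the reciprocal\<close>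

lemma truncation_form_le:
  assumes X: "self_adjoint X" and pos: "\<And>x. 0 \<le> x \<bullet> X x"
    and le: "\<And>x. x \<bullet> X x \<le> 2 * (x \<bullet> x)"
  shows "(X w \<bullet> X w + (2 *\<^sub>R X w - X (X w)) \<bullet> (2 *\<^sub>R X w - X (X w))) / 2 \<le> w \<bullet> X w"
  \<comment> \<open>\<open>1 - x f(x) = (1 - x)\<^sup>2 (2 - x) / 2\<close>\<close>
  using norm_image_le_form[OF X pos le, of "w - X w"]
  by (simp add: self_adjoint_expand[OF X] inner_simps algebra_simps)

text \<open>At \<open>v = X w\<close> this is \<open>x f(x) >= E\<close> for a spectrum in
  \<open>[E, 1 / E]\<close>. The certificate changes with \<open>E\<close>: the first one needs
  \<open>1 - 2 E >= 0\<close>, the second needs \<open>3 E >= 1\<close> and a division by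
  \<open>1 - E^2\<close>.\<close>

lemma truncation_form_ge:
  assumes X: "self_adjoint X" and E: "0 < E" "E \<le> 1"
    and ge: "\<And>x. E * (x \<bullet> x) \<le> x \<bullet> X x" and le: "\<And>x. E * (x \<bullet> X x) \<le> x \<bullet> x"
  shows "E * (w \<bullet> X w)
    \<le> (X w \<bullet> X w + (2 *\<^sub>R X w - X (X w)) \<bullet> (2 *\<^sub>R X w - X (X w))) / 2"
proof -
  have pos: "0 \<le> x \<bullet> X x" for x
    using ge[of x] E by (meson inner_ge_zero less_imp_le mult_nonneg_nonneg order_trans)
  \<comment> \<open>These are the moments of \<open>X\<close> at \<open>w\<close>. The claim is
    linear in them, so a polynomial identity in \<open>x\<close> can be checked coefficient by
    coefficient.\<close>
  define s1 s2 s3 s4 where "s1 = X w \<bullet> w" and "s2 = X (X w) \<bullet> w"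
    and "s3 = X (X (X w)) \<bullet> w" and "s4 = X (X (X (X w))) \<bullet> w"
  note expand = self_adjoint_expand[OF X] inner_simps s1_def[symmetric] s2_def[symmetric]
    s3_def[symmetric] s4_def[symmetric]
  have s1: "0 \<le> s1" using pos[of w] by (simp add: expand)
  have s2: "0 \<le> s2" using inner_ge_zero[of "X w"] by (simp add: expand)
  consider "E \<le> 1 / 2" | "1 / 2 \<le> E" "E < 1" | "E = 1" using E by linarith
  then have "E * s1 \<le> 5 / 2 * s2 - 2 * s3 + s4 / 2"
  proof cases
    \<comment> \<open>\<open>2 (x f(x) - E) = (x - E) (x - 2)\<^sup>2 + E (x - 1)\<^sup>2 + E + (1 - 2 E) x\<close>\<close>
    case 1
    have "E * ((X w - 2 *\<^sub>R w) \<bullet> X (X w - 2 *\<^sub>R w)) \<le> X (X w - 2 *\<^sub>R w) \<bullet> X (X w - 2 *\<^sub>R w)"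
      using form_le_norm_image[OF X ge] E by simp
    moreover have "0 \<le> E * ((X w - w) \<bullet> X (X w - w))" using pos E by simp
    moreover have "0 \<le> E * s1" "0 \<le> (1 - 2 * E) * s2" using s1 s2 E 1 by simp_all
    ultimately show ?thesis by (simp add: expand algebra_simps)
  next
    \<comment> \<open>On \<open>[E, 1 / E]\<close> the convex function \<open>E / x\<close> lies below its chord \<open>1 + E\<^sup>2 - E x\<close>, and
      \<open>f(x) - (1 + E\<^sup>2 - E x) = ((x - (2 - E))\<^sup>2 + (3 E - 1) (1 - E)) / 2\<close>.\<close>
    case 2
    have a: "0 \<le> (X (X w) - (2 - E) *\<^sub>R X w) \<bullet> (X (X w) - (2 - E) *\<^sub>R X w)" by simp
    have b: "0 \<le> ((3 * E - 1) * (1 - E)) * s2" using s2 E 2 by simp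
    have c: "E * ((X w - E *\<^sub>R w) \<bullet> X (X w - E *\<^sub>R w)) \<le> (X w - E *\<^sub>R w) \<bullet> (X w - E *\<^sub>R w)"
      by (rule le)
    have d: "E * ((w - E *\<^sub>R X w) \<bullet> (w - E *\<^sub>R X w)) \<le> (w - E *\<^sub>R X w) \<bullet> X (w - E *\<^sub>R X w)"
      by (rule ge)
    define s0 where "s0 = w \<bullet> w"
    note expand = expand s0_def[symmetric]
    \<comment> \<open>In terms of polynomials, \<open>t\<close> is \<open>(x - E) (1 - E x)\<close>,
      which is \<open>x\<close> times the gap between chord and \<open>E / x\<close>, and
      \<open>r\<close> is \<open>(x - E)^2 (1 - E x)\<close>. Adding
      \<open>(x - E) (1 - E x)^2\<close> to \<open>E r\<close> gives
      \<open>(1 - E^2) t\<close>.\<close>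
    define t where "t = (1 + E^2) * s1 - E * s2 - E * s0"
    define r where "r = s2 - 2 * E * s1 + E^2 * s0 - E * (s3 - 2 * E * s2 + E^2 * s1)"
    have r: "0 \<le> r"
      using c by (simp add: r_def expand algebra_simps power2_eq_square)
    have "0 \<le> E * r + (s1 - 2 * E * s2 + E^2 * s3 - E * (s0 - 2 * E * s1 + E^2 * s2))"
      using d E r by (intro add_nonneg_nonneg) (simp_all add: expand algebra_simps power2_eq_square)
    also have "\<dots> = (1 - E^2) * t"
      by (simp add: r_def t_def algebra_simps power2_eq_square)
    finally have "0 \<le> (1 - E^2) * t" .
    moreover have "E^2 < 1" using E 2 by (simp add: power_less_one_iff)
    ultimately have "0 \<le> t" by (simp add: zero_le_mult_iff)
    \<comment> \<open>\<open>r + E t\<close> is \<open>x (x - E) (1 - E x)\<close>, the chord bound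
      weighted by \<open>x^2\<close>.\<close>
    then have "0 \<le> r + E * t" using r E by simp
    then have "0 \<le> s2 + E^2 * s2 - E * s3 - E * s1"
      by (simp add: r_def t_def algebra_simps power2_eq_square)
    then show ?thesis using a b
      by (simp add: expand algebra_simps power2_eq_square)
  next
    case 3
    \<comment> \<open>Only \<open>x = 1\<close> remains; the test vectors below force
      \<open>s1\<close> to \<open>s4\<close> to coincide.\<close>
    have eq: "z \<bullet> X z = z \<bullet> z" for z using ge[of z] le[of z] 3 by simp
    show ?thesis using eq[of w] eq[of "X w"] eq[of "w - X w"] eq[of "X w - X (X w)"]
        eq[of "X (X w)"] 3
      by (simp add: expand)
  qed
  then show ?thesis by (simp add: expand algebra_simps)
qed

section \<open>Comparison of inverses\<close>

text \<open>With \<open>v = A w = B u\<close> this says \<open>B^-1 <= c A^-1\<close> at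
  \<open>v\<close>. It follows by completing the square: \<open>A\<close> is nonnegative at
  \<open>c w - u\<close>.\<close>

lemma inverse_form_antimono:
  assumes A: "self_adjoint A" and pos: "\<And>x. 0 \<le> x \<bullet> A x"
    and le: "\<And>x. x \<bullet> A x \<le> c * (x \<bullet> B x)" and c: "c > 0" and eq: "A w = B u"
  shows "u \<bullet> B u \<le> c * (w \<bullet> A w)"
proof -
  have "0 \<le> (c *\<^sub>R w - u) \<bullet> A (c *\<^sub>R w - u)" by (rule pos)
  also have "\<dots> = c * (c * (w \<bullet> A w)) - 2 * c * (u \<bullet> B u) + u \<bullet> A u"
    using self_adjoint_inner[OF A, of u w] eq
    by (simp add: linear_diff[OF self_adjoint_linear[OF A]] linear_scale[OF self_adjoint_linear[OF A]]
        inner_diff_left inner_diff_right algebra_simps inner_commute)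
  also have "\<dots> \<le> c * (c * (w \<bullet> A w)) - c * (u \<bullet> B u)"
    using le[of u] by simp
  finally show ?thesis using c by simp
qed

lemma positive_definite_surj:
  fixes X :: "'a::euclidean_space \<Rightarrow> 'a"
  assumes "linear X" "\<And>x. x \<noteq> 0 \<Longrightarrow> 0 < x \<bullet> X x"
  shows "surj X"
proof -
  have "inj X"
    using assms by (intro linear_injective_0[THEN iffD2]) (auto, fastforce)
  then show ?thesis using assms linear_injective_imp_surjective by blast
qed

section \<open>Walk products and the recursion of the walk form\<close>

text \<open>The operator version of \<open>right_prod\<close>: \<open>N 0\<close> acts
  first.\<close>

primrec walk_prod :: "(nat \<Rightarrow> 'a \<Rightarrow> 'a) \<Rightarrow> nat \<Rightarrow> 'a::real_inner \<Rightarrow> 'a" where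
  "walk_prod N 0 v = v + N 0 v"
| "walk_prod N (Suc i) v = walk_prod N i v + N (Suc i) (walk_prod N i v)"

text \<open>The quadratic form of the theorem's right-hand side, with the identity in place of
  \<open>I - J\<close>.\<close>

definition walk_form :: "(nat \<Rightarrow> 'a \<Rightarrow> 'a) \<Rightarrow> nat \<Rightarrow> 'a::real_inner \<Rightarrow> real" where
  "walk_form N k v = v \<bullet> v / 2
    + (\<Sum>i<k. walk_prod N i v \<bullet> walk_prod N i v / 2 ^ (i + 2))
    + walk_prod N k v \<bullet> walk_prod N k v / 2 ^ (k + 1)"

lemma walk_prod_shift: "walk_prod N (Suc i) v = walk_prod (\<lambda>i. N (Suc i)) i (v + N 0 v)"
  by (induction i) auto

lemma walk_form_0: "walk_form N 0 v = (v \<bullet> v + (v + N 0 v) \<bullet> (v + N 0 v)) / 2"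
  by (simp add: walk_form_def)

text \<open>Counterpart of \<open>L^-1 = (I + (I + N 0) A^-1 (I + N 0)) / 2\<close>: the summand
  \<open>i = 0\<close>, of weight \<open>1 / 4\<close>, becomes half the leading term of the shifted
  form.\<close>

lemma walk_form_Suc:
  "walk_form N (Suc k) v = (v \<bullet> v + walk_form (\<lambda>i. N (Suc i)) k (v + N 0 v)) / 2"
proof -
  let ?g = "\<lambda>i. walk_prod (\<lambda>i. N (Suc i)) i (v + N 0 v)"
  have "(\<Sum>i<Suc k. walk_prod N i v \<bullet> walk_prod N i v / 2 ^ (i + 2))
      = (v + N 0 v) \<bullet> (v + N 0 v) / 4 + (\<Sum>i<k. ?g i \<bullet> ?g i / 2 ^ (i + 2)) / 2"
    by (subst sum.lessThan_Suc_shift)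
      (simp add: walk_prod_shift sum_divide_distrib mult.commute del: walk_prod.simps(2))
  then show ?thesis
    unfolding walk_form_def walk_prod_shift by (simp add: field_simps)
qed

text \<open>For every \<open>x > 0\<close>, \<open>f(x) <= 1 / x + x^2 / 2\<close>. Each of the two
  summands is bounded by \<open>a b / 2\<close> times the inverse of \<open>I - N^2\<close>.\<close>

lemma truncation_form_le_two_step:
  fixes N X :: "'a::euclidean_space \<Rightarrow> 'a"
  assumes N: "self_adjoint N" and X: "self_adjoint X"
    and a: "2 \<le> a" and b: "2 \<le> b"
    and posA: "\<And>x. 0 \<le> x \<bullet> (x - N (N x))"
    and posX: "\<And>x. 0 \<le> x \<bullet> X x"
    and XA: "\<And>x. x \<bullet> X x \<le> a * (x \<bullet> (x - N (N x)))"
    and AX: "\<And>x. x \<bullet> (x - N (N x)) \<le> a * (x \<bullet> X x)"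
    and Xb: "\<And>x. x \<bullet> X x \<le> b * (x \<bullet> x)"
    and eq: "w - N (N w) = X u"
  shows "(X u \<bullet> X u + (2 *\<^sub>R X u - X (X u)) \<bullet> (2 *\<^sub>R X u - X (X u))) / 2
    \<le> a * b * (w \<bullet> (w - N (N w)))"
proof -
  define A where "A = (\<lambda>x. x - N (N x))"
  have A: "self_adjoint A"
    unfolding A_def by (intro self_adjoint_id_minus self_adjoint_compose_self N)
  have Aw: "A w = X u" using eq by (simp add: A_def)
  have u: "u \<bullet> X u \<le> a * (w \<bullet> A w)"
    using AX a by (intro inverse_form_antimono[where B = X, OF A]) (auto simp: A_def posA eq)
  \<comment> \<open>At \<open>v = A w\<close> the chain is
    \<open>X^2 <= b X <= a b A <= a b I <= a b A^-1\<close>.\<close>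
  have "X (A w) \<bullet> X (A w) \<le> b * (A w \<bullet> X (A w))"
    using b by (intro norm_image_le_form[OF X posX Xb]) auto
  also have "A w \<bullet> X (A w) \<le> a * (A w \<bullet> A (A w))"
    using XA by (simp add: A_def)
  also have "A w \<bullet> A (A w) \<le> A w \<bullet> A w"
    using inner_ge_zero[of "N (A w)"] self_adjoint_inner[OF N, of "A w" "N (A w)"]
    by (simp add: A_def[THEN fun_cong, of "A w"] inner_diff_right)
  also have "A w \<bullet> A w \<le> 1 * (w \<bullet> A w)"
  proof (rule norm_image_le_form[OF A])
    show "x \<bullet> A x \<le> 1 * (x \<bullet> x)" for x
      using inner_ge_zero[of "N x"] self_adjoint_inner[OF N, of x "N x"]
      by (simp add: A_def inner_diff_right)
  qed (simp_all add: posA A_def)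
  finally have XX: "X (X u) \<bullet> X (X u) \<le> a * b * (w \<bullet> A w)"
    using a b by (simp add: Aw mult_le_cancel_left mult.assoc mult.left_commute)
  \<comment> \<open>\<open>1 / x - 5 / 2 + 2 x = (2 (x - 5 / 8)\<^sup>2 + 7 / 32) / x\<close>\<close>
  have "0 \<le> 2 * ((X u - (5/8) *\<^sub>R u) \<bullet> X (X u - (5/8) *\<^sub>R u)) + 7 / 32 * (u \<bullet> X u)"
    by (intro add_nonneg_nonneg mult_nonneg_nonneg posX) simp_all
  then have "(X u \<bullet> X u + (2 *\<^sub>R X u - X (X u)) \<bullet> (2 *\<^sub>R X u - X (X u))) / 2
      \<le> u \<bullet> X u + X (X u) \<bullet> X (X u) / 2"
    by (simp add: self_adjoint_expand[OF X] inner_simps algebra_simps)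
  also have "\<dots> \<le> a * b / 2 * (w \<bullet> A w) + a * b * (w \<bullet> A w) / 2"
  proof (intro add_mono)
    \<comment> \<open>Here \<open>b >= 2\<close> pays for replacing \<open>a\<close> by
      \<open>a b / 2\<close>.\<close>
    have "2 * (a * (w \<bullet> A w)) \<le> b * (a * (w \<bullet> A w))"
      using a b posA[of w] by (intro mult_right_mono mult_nonneg_nonneg) (auto simp: A_def)
    with u show "u \<bullet> X u \<le> a * b / 2 * (w \<bullet> A w)" by (simp add: mult_ac)
  qed (use XX in simp)
  finally show ?thesis by (simp add: A_def)
qed

section \<open>Induction over the levels\<close>

text \<open>Definiteness travels down from level \<open>k\<close>: \<open>I - N (Suc i)\<close>
  controls \<open>I - (N i)^2\<close> from below, and
  \<open>2 (I - N i) = (I - (N i)^2) + (I - N i)^2\<close>.\<close>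

lemma sandwich_positive_definite:
  fixes N :: "nat \<Rightarrow> 'a::real_inner \<Rightarrow> 'a"
  assumes "\<And>i. i \<le> k \<Longrightarrow> self_adjoint (N i)"
    and "\<And>i x. i < k \<Longrightarrow> exp (- \<epsilon> i) * (x \<bullet> (x - N (Suc i) x)) \<le> x \<bullet> (x - N i (N i x))"
    and "\<And>x. x \<bullet> x \<le> exp (\<epsilon> k) * (x \<bullet> (x - N k x))"
    and "x \<noteq> 0"
  shows "0 < x \<bullet> (x - N 0 x)"
  using assms
proof (induction k arbitrary: N \<epsilon> x)
  case 0
  have "0 < x \<bullet> x" using "0.prems"(4) by simp
  also have "\<dots> \<le> exp (\<epsilon> 0) * (x \<bullet> (x - N 0 x))" by (rule "0.prems")
  finally show ?case by (simp add: zero_less_mult_iff)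
next
  case (Suc k)
  have N: "self_adjoint (N 0)" by (simp add: Suc.prems(1))
  have "0 < x \<bullet> (x - N (Suc 0) x)"
    by (rule Suc.IH[of "\<lambda>i. N (Suc i)" "\<lambda>i. \<epsilon> (Suc i)"])
      (simp_all only: Suc.prems Suc_le_mono Suc_less_eq not_False_eq_True)
  then have "0 < exp (- \<epsilon> 0) * (x \<bullet> (x - N (Suc 0) x))" by simp
  also have "\<dots> \<le> x \<bullet> (x - N 0 (N 0 x))" by (simp add: Suc.prems(2))
  also have "\<dots> = 2 * (x \<bullet> (x - N 0 x)) - (x - N 0 x) \<bullet> (x - N 0 x)"
    by (simp add: self_adjoint_expand[OF N] inner_simps)
  finally show ?case using inner_ge_zero[of "x - N 0 x"] by linarith
qed

text \<open>The last assumption is guarded by \<open>k = 0\<close> because only the terminal level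
  compares \<open>f\<close> with the reciprocal. The shifted sequence may violate it when it has
  length one, which is the separate case of the induction step.\<close>

lemma walk_form_approx:
  fixes N :: "nat \<Rightarrow> 'a::euclidean_space \<Rightarrow> 'a"
  assumes "\<And>i. i \<le> k \<Longrightarrow> 0 \<le> \<epsilon> i"
    and "\<And>i. i \<le> k \<Longrightarrow> self_adjoint (N i)"
    and "\<And>i x. i < k \<Longrightarrow> exp (- \<epsilon> i) * (x \<bullet> (x - N (Suc i) x)) \<le> x \<bullet> (x - N i (N i x))"
    and "\<And>i x. i < k \<Longrightarrow> x \<bullet> (x - N i (N i x)) \<le> exp (\<epsilon> i) * (x \<bullet> (x - N (Suc i) x))"
    and "\<And>x. exp (- \<epsilon> k) * (x \<bullet> (x - N k x)) \<le> x \<bullet> x"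
    and "\<And>x. x \<bullet> x \<le> exp (\<epsilon> k) * (x \<bullet> (x - N k x))"
    and "\<And>x. k = 0 \<Longrightarrow> 0 \<le> x \<bullet> (x + N 0 x)"
  shows "exp (- (\<Sum>i\<le>k. \<epsilon> i)) * (w \<bullet> (w - N 0 w)) \<le> walk_form N k (w - N 0 w)
    \<and> walk_form N k (w - N 0 w) \<le> exp (\<Sum>i\<le>k. \<epsilon> i) * (w \<bullet> (w - N 0 w))"
  using assms
proof (induction k arbitrary: N \<epsilon> w)
  case 0
  define X where "X = (\<lambda>x. x - N 0 x)"
  have X: "self_adjoint X" unfolding X_def by (intro self_adjoint_id_minus "0.prems") simp
  have N: "y + N 0 y = 2 *\<^sub>R y - X y" for y by (simp add: X_def scaleR_2)
  have pos: "0 \<le> x \<bullet> X x" for x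
    using order.trans[OF inner_ge_zero "0.prems"(6)[of x]] by (simp add: X_def zero_le_mult_iff)
  have form: "walk_form N 0 (X w)
      = (X w \<bullet> X w + (2 *\<^sub>R X w - X (X w)) \<bullet> (2 *\<^sub>R X w - X (X w))) / 2"
    by (simp add: walk_form_0 N)
  have "exp (- \<epsilon> 0) * (w \<bullet> X w) \<le> walk_form N 0 (X w)"
    unfolding form
  proof (rule truncation_form_ge[OF X])
    show "exp (- \<epsilon> 0) * (x \<bullet> x) \<le> x \<bullet> X x" for x
      using "0.prems"(6)[of x] by (simp add: X_def exp_minus field_simps)
    show "exp (- \<epsilon> 0) * (x \<bullet> X x) \<le> x \<bullet> x" for x
      using "0.prems"(5)[of x] by (simp add: X_def)
  qed (use "0.prems"(1) in simp_all)
  moreover have "walk_form N 0 (X w) \<le> w \<bullet> X w"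
    unfolding form
  proof (rule truncation_form_le[OF X pos])
    show "x \<bullet> X x \<le> 2 * (x \<bullet> x)" for x
      using "0.prems"(7)[of x] by (simp add: X_def inner_simps)
  qed
  moreover have "w \<bullet> X w \<le> exp (\<epsilon> 0) * (w \<bullet> X w)"
    using pos[of w] "0.prems"(1)[of 0] by (simp add: mult_le_cancel_right1)
  ultimately show ?case by (simp add: X_def)
next
  case (Suc k)
  define N' where "N' = (\<lambda>i. N (Suc i))"
  define \<epsilon>' where "\<epsilon>' = (\<lambda>i. \<epsilon> (Suc i))"
  define X where "X = (\<lambda>x. x - N' 0 x)"
  define A where "A = (\<lambda>x. x - N 0 (N 0 x))"
  note N'_def [simp] \<epsilon>'_def [simp]
  let ?s = "\<Sum>i\<le>k. \<epsilon>' i"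
  have N: "self_adjoint (N 0)" using Suc.prems(2) by simp
  have A: "self_adjoint A"
    unfolding A_def by (intro self_adjoint_id_minus self_adjoint_compose_self N)
  have X: "self_adjoint X"
    unfolding X_def using Suc.prems(2) by (intro self_adjoint_id_minus) auto
  have pd: "0 < x \<bullet> X x" if "x \<noteq> 0" for x
    unfolding X_def using that
    by (intro sandwich_positive_definite[of k N' \<epsilon>']) (simp_all add: Suc.prems(2,3,6))
  then have posX: "0 \<le> x \<bullet> X x" for x
    by (cases "x = 0") (auto intro: less_imp_le)
  have lo: "exp (- \<epsilon> 0) * (x \<bullet> X x) \<le> x \<bullet> A x" for x
    using Suc.prems(3)[of 0 x] by (simp add: X_def A_def)
  then have lo': "x \<bullet> X x \<le> exp (\<epsilon> 0) * (x \<bullet> A x)" for x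
    by (simp add: exp_minus field_simps)
  have up: "x \<bullet> A x \<le> exp (\<epsilon> 0) * (x \<bullet> X x)" for x
    using Suc.prems(4)[of 0 x] by (simp add: X_def A_def)
  have posA: "0 \<le> x \<bullet> A x" for x
    using order.trans[OF mult_nonneg_nonneg[OF exp_ge_zero posX] lo] .
  \<comment> \<open>\<open>A w\<close> is the argument for the next level; with this
    \<open>u\<close>, the forms \<open>w . A w\<close> and \<open>u . X u\<close> are those of
    \<open>A^-1\<close> and \<open>X^-1\<close> at the same vector.\<close>
  obtain u where u: "A w = X u"
    using positive_definite_surj[OF self_adjoint_linear[OF X] pd] by (metis surjD)
  have uw: "u \<bullet> X u \<le> exp (\<epsilon> 0) * (w \<bullet> A w)"
    by (intro inverse_form_antimono[where B = X, OF A posA up]) (auto simp: u)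
  have wu: "w \<bullet> A w \<le> exp (\<epsilon> 0) * (u \<bullet> X u)"
    by (intro inverse_form_antimono[where B = A, OF X posX lo']) (auto simp: u)
  have terminal: "walk_form N' 0 (X u)
      = (X u \<bullet> X u + (2 *\<^sub>R X u - X (X u)) \<bullet> (2 *\<^sub>R X u - X (X u))) / 2"
    by (simp add: walk_form_0 X_def scaleR_2 add.commute)
  have rest: "exp (- (\<epsilon> 0 + ?s)) * (w \<bullet> A w) \<le> walk_form N' k (X u)
      \<and> walk_form N' k (X u) \<le> exp (\<epsilon> 0 + ?s) * (w \<bullet> A w)"
  proof (cases "k = 0 \<longrightarrow> (\<forall>x. 0 \<le> x \<bullet> (x + N' 0 x))")
    case True
    have IH: "exp (- ?s) * (u \<bullet> X u) \<le> walk_form N' k (X u)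
        \<and> walk_form N' k (X u) \<le> exp ?s * (u \<bullet> X u)"
      unfolding X_def using True by (intro Suc.IH) (simp_all add: Suc.prems(1-6))
    have "exp (- \<epsilon> 0) * (w \<bullet> A w) \<le> u \<bullet> X u"
      using wu by (simp add: exp_minus field_simps)
    then have "exp (- ?s) * (exp (- \<epsilon> 0) * (w \<bullet> A w)) \<le> exp (- ?s) * (u \<bullet> X u)" by simp
    moreover have "exp ?s * (u \<bullet> X u) \<le> exp ?s * (exp (\<epsilon> 0) * (w \<bullet> A w))" using uw by simp
    ultimately show ?thesis
      using IH unfolding minus_add_distrib exp_add by (simp only: mult_ac) linarith
  next
    case False
    then have k: "k = 0" by blast
    from False obtain z where z: "z \<bullet> (z + N' 0 z) < 0" by (auto simp: not_le)
    then have zX: "2 * (z \<bullet> z) < z \<bullet> X z" by (simp add: X_def inner_simps)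
    have Xb: "x \<bullet> X x \<le> exp (\<epsilon> 1) * (x \<bullet> x)" for x
      using Suc.prems(5)[of x] k by (simp add: X_def exp_minus field_simps)
    have "x \<bullet> A x \<le> x \<bullet> x" for x
      using inner_ge_zero[of "N 0 x"] by (simp add: A_def self_adjoint_inner[OF N] inner_simps)
    then have Xa: "x \<bullet> X x \<le> exp (\<epsilon> 0) * (x \<bullet> x)" for x
      using lo'[of x] by (meson exp_ge_zero mult_left_mono order.trans)
    \<comment> \<open>The Rayleigh quotient of \<open>X\<close> at \<open>z\<close> exceeds
      \<open>2\<close>, so every upper bound for \<open>X\<close> does. Both
      \<open>exp (\<epsilon> 0)\<close> and \<open>exp (\<epsilon> 1)\<close> are such bounds, the
      former because \<open>A <= I\<close>.\<close>
    have big: "2 \<le> c" if "z \<bullet> X z \<le> c * (z \<bullet> z)" for c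
    proof (rule ccontr)
      assume "\<not> 2 \<le> c"
      then have "c * (z \<bullet> z) \<le> 2 * (z \<bullet> z)" by (intro mult_right_mono) auto
      with that zX show False by linarith
    qed
    have "walk_form N' k (X u) \<le> exp (\<epsilon> 0) * exp (\<epsilon> 1) * (w \<bullet> A w)"
      unfolding k terminal A_def
      by (intro truncation_form_le_two_step[OF N X big[OF Xa] big[OF Xb]])
        (use posA posX lo' up Xb u in \<open>auto simp: A_def\<close>)
    moreover have "exp (- \<epsilon> 0) * (exp (- \<epsilon> 1) * (w \<bullet> A w)) \<le> walk_form N' k (X u)"
    proof -
      have "exp (- \<epsilon> 1) * (u \<bullet> X u) \<le> walk_form N' k (X u)"
        unfolding k terminal
      proof (rule truncation_form_ge[OF X])
        show "exp (- \<epsilon> 1) * (x \<bullet> x) \<le> x \<bullet> X x" for x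
          using Suc.prems(6)[of x] k by (simp add: X_def exp_minus field_simps)
        show "exp (- \<epsilon> 1) * (x \<bullet> X x) \<le> x \<bullet> x" for x
          using Suc.prems(5)[of x] k by (simp add: X_def)
      qed (use Suc.prems(1)[of 1] in simp_all)
      moreover have "exp (- \<epsilon> 1) * (exp (- \<epsilon> 0) * (w \<bullet> A w)) \<le> exp (- \<epsilon> 1) * (u \<bullet> X u)"
        using wu by (intro mult_left_mono) (simp_all add: exp_minus field_simps)
      ultimately show ?thesis by (simp only: mult_ac)
    qed
    ultimately show ?thesis by (simp add: k exp_add exp_diff exp_minus field_simps)
  qed
  define v where "v = w - N 0 w"
  have "v + N 0 v = X u"
    unfolding u[symmetric] by (simp add: v_def A_def linear_diff[OF self_adjoint_linear[OF N]])
  then have form: "walk_form N (Suc k) v = (v \<bullet> v + walk_form N' k (X u)) / 2"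
    by (simp add: walk_form_Suc)
  \<comment> \<open>The recursion for \<open>L^-1\<close> at \<open>v = L w\<close>:
    \<open>2 (1 - n) = (1 - n)^2 + (1 - n^2)\<close>.\<close>
  have split: "w \<bullet> v = (v \<bullet> v + w \<bullet> A w) / 2"
    by (simp add: v_def A_def self_adjoint_expand[OF N] inner_simps)
  have sum: "(\<Sum>i\<le>Suc k. \<epsilon> i) = \<epsilon> 0 + ?s"
    by (simp add: sum.atMost_Suc_shift del: sum.atMost_Suc)
  \<comment> \<open>The term \<open>v . v\<close> occurs exactly on both sides; a nonnegative total
    error lets it absorb the same exponential factors.\<close>
  have "0 \<le> \<epsilon> 0 + ?s"
    by (intro add_nonneg_nonneg sum_nonneg) (simp_all add: Suc.prems(1))
  then have "exp (- (\<epsilon> 0 + ?s)) * (v \<bullet> v) \<le> 1 * (v \<bullet> v)"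
    and "1 * (v \<bullet> v) \<le> exp (\<epsilon> 0 + ?s) * (v \<bullet> v)"
    by (intro mult_right_mono; simp)+
  with rest show ?case
    unfolding v_def[symmetric] form split sum by (simp add: distrib_left)
qed

subsection \<open>Matrices\<close>

lemma matrix_mult_diff_left: "A ** (B - C) = A ** B - A ** (C :: 'a::ring_1 ^ 'p ^ 'n)"
  by (simp add: matrix_matrix_mult_def vec_eq_iff right_diff_distrib sum_subtractf)

lemma matrix_mult_diff_right: "(B - C) ** A = B ** A - C ** (A :: 'a::ring_1 ^ 'p ^ 'n)"
  by (simp add: matrix_matrix_mult_def vec_eq_iff left_diff_distrib sum_subtractf)

lemma transpose_add: "transpose (A + B) = transpose A + transpose B"
  by (simp add: transpose_def vec_eq_iff)

lemma transpose_diff: "transpose (A - B) = transpose A - transpose B"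
  by (simp add: transpose_def vec_eq_iff)

lemma matrix_mult_add_right: "(B + C) ** A = B ** A + C ** (A :: 'a::semiring_1 ^ 'p ^ 'n)"
  by (simp add: matrix_matrix_mult_def vec_eq_iff distrib_right sum.distrib)

lemma transpose_sum: "transpose (\<Sum>i\<in>I. A i) = (\<Sum>i\<in>I. transpose (A i))"
  by (simp add: transpose_def vec_eq_iff)

lemma sum_matrix_vector_mult:
  fixes x :: "real ^ 'n"
  shows "(\<Sum>i\<in>I. A i) *v x = (\<Sum>i\<in>I. A i *v x)"
  by (induction I rule: infinite_finite_induct) (simp_all add: matrix_vector_mult_add_rdistrib)

lemma inner_matrix_vector_transpose:
  fixes A :: "real ^ 'n ^ 'm"
  shows "x \<bullet> (A *v y) = (transpose A *v x) \<bullet> y"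
  by (simp add: dot_lmul_matrix)

lemma self_adjoint_matrix:
  fixes A :: "real ^ 'n ^ 'n"
  assumes "symmetric_mat A"
  shows "self_adjoint ((*v) A)"
  unfolding self_adjoint_def
proof (intro conjI allI)
  show "x \<bullet> (A *v y) = (A *v x) \<bullet> y" for x y
    using inner_matrix_vector_transpose[of x A y] assms unfolding symmetric_mat_def by simp
qed simp

text \<open>A step from \<open>x\<close> along \<open>- A x\<close> lowers the form to first order,
  which positivity forbids unless \<open>A x\<close> vanishes.\<close>

lemma psd_form_eq_0:
  assumes A: "psd A" and x: "x \<bullet> (A *v x) \<le> 0"
  shows "A *v x = 0"
proof (rule ccontr)
  define y where "y = A *v x"
  assume "A *v x \<noteq> 0"
  then have y: "0 < y \<bullet> y" by (simp add: y_def)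
  have sa: "self_adjoint ((*v) A)" using A by (simp add: psd_def self_adjoint_matrix)
  define C where "C = y \<bullet> (A *v y)"
  have C: "0 \<le> C" using A by (simp add: psd_def C_def)
  \<comment> \<open>Small enough that the quadratic term \<open>t C\<close> stays below
    \<open>y . y\<close>; the \<open>+ 1\<close> covers \<open>C = 0\<close>.\<close>
  define t where "t = y \<bullet> y / (C + 1)"
  have "t > 0" using y C by (simp add: t_def)
  have "0 \<le> (x - t *\<^sub>R y) \<bullet> (A *v (x - t *\<^sub>R y))" using A by (simp add: psd_def)
  also have "\<dots> = x \<bullet> (A *v x) - 2 * t * (y \<bullet> y) + t * (t * C)"
    using self_adjoint_inner[OF sa, of x y]
    by (simp add: matrix_vector_mult_diff_distrib matrix_vector_mult_scaleR inner_diff_left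
        inner_diff_right right_diff_distrib C_def flip: y_def)
  finally have "t * (2 * (y \<bullet> y)) \<le> t * (t * C)" using x by simp
  then have "2 * (y \<bullet> y) \<le> t * C" using \<open>t > 0\<close> by simp
  also have "\<dots> \<le> y \<bullet> y" using C y by (simp add: t_def divide_simps)
  finally show False using y by simp
qed

lemma approx_mat_form:
  assumes "approx_mat \<epsilon> X Y"
  shows "exp (- \<epsilon>) * (x \<bullet> (X *v x)) \<le> x \<bullet> (Y *v x)"
    and "x \<bullet> (Y *v x) \<le> exp \<epsilon> * (x \<bullet> (X *v x))"
  using assms
  by (simp_all add: approx_mat_def loewner_le_def psd_def inner_diff_right
      matrix_vector_mult_diff_rdistrib flip: scaleR_matrix_vector_assoc)

lemma approx_matI:
  assumes "symmetric_mat X" "symmetric_mat Y"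
    and "\<And>x. exp (- \<epsilon>) * (x \<bullet> (X *v x)) \<le> x \<bullet> (Y *v x)"
    and "\<And>x. x \<bullet> (Y *v x) \<le> exp \<epsilon> * (x \<bullet> (X *v x))"
  shows "approx_mat \<epsilon> X Y"
  using assms
  by (simp add: approx_mat_def loewner_le_def psd_def inner_diff_right symmetric_mat_def
      transpose_diff transpose_scalar matrix_vector_mult_diff_rdistrib
      flip: scaleR_matrix_vector_assoc)

section \<open>The averaging projection and the pseudoinverse\<close>

lemma transpose_J [simp]: "transpose J_mat = J_mat"
  by (simp add: J_mat_def transpose_def)

lemma symmetric_J: "symmetric_mat J_mat"
  by (simp add: symmetric_mat_def)

lemma J_vec: "(J_mat :: real ^ 'n ^ 'n) *v x = ((\<Sum>i\<in>UNIV. x $ i) / real CARD('n)) *\<^sub>R (\<chi> i. 1)"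
  by (simp add: J_mat_def matrix_vector_mult_def vec_eq_iff sum_divide_distrib)

lemma J_ones: "(J_mat :: real ^ 'n ^ 'n) *v (\<chi> i. 1) = (\<chi> i. 1)"
  by (simp add: J_vec vec_eq_iff)

lemma mult_J_vec:
  fixes A :: "real ^ 'n ^ 'n"
  assumes "A *v (\<chi> i. 1) = (\<chi> i. 1)"
  shows "A *v (J_mat *v x) = J_mat *v x"
  using assms by (simp add: J_vec matrix_vector_mult_scaleR)

lemma mult_J:
  fixes A :: "real ^ 'n ^ 'n"
  assumes "A *v (\<chi> i. 1) = (\<chi> i. 1)"
  shows "A ** J_mat = J_mat"
  using mult_J_vec[OF assms] by (simp add: matrix_eq flip: matrix_vector_mul_assoc)

lemma J_mult:
  fixes A :: "real ^ 'n ^ 'n"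
  assumes "symmetric_mat A" "A *v (\<chi> i. 1) = (\<chi> i. 1)"
  shows "J_mat ** A = J_mat"
  using arg_cong[OF mult_J[OF assms(2)], of transpose] assms(1)
  by (simp add: matrix_transpose_mul symmetric_mat_def)

lemma J_idem: "J_mat ** J_mat = (J_mat :: real ^ 'n ^ 'n)"
  by (rule mult_J[OF J_ones])

text \<open>\<open>L\<close> and \<open>J\<close> annihilate each other, so \<open>L + J\<close>
  acts as \<open>L\<close> on the complement of the ones and as the identity on the ones. Its
  inverse is therefore the pseudoinverse plus \<open>J\<close>.\<close>

lemma pinv_eq_inverse_minus_J:
  fixes L :: "real ^ 'n ^ 'n"
  assumes L: "symmetric_mat L" and LJ: "L ** J_mat = 0"
    and H: "(L + J_mat) ** H = mat 1"
  shows "pinv L = H - J_mat" and "symmetric_mat H" and "H ** J_mat = J_mat" and "J_mat ** H = J_mat"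
proof -
  let ?G = "L + J_mat"
  have HG: "H ** ?G = mat 1" using H matrix_left_right_inverse by blast
  have "transpose ?G = ?G" using L by (simp add: symmetric_mat_def transpose_add)
  then have tH: "transpose H ** ?G = mat 1"
    using arg_cong[OF H, of transpose] by (simp add: matrix_transpose_mul)
  have "transpose H = transpose H ** (?G ** H)" by (simp add: H)
  also have "\<dots> = H" by (simp add: matrix_mul_assoc tH)
  finally have sH: "transpose H = H" .
  then show "symmetric_mat H" by (simp add: symmetric_mat_def)
  have GJ: "?G ** J_mat = J_mat" by (simp add: matrix_mult_add_right LJ J_idem)
  have "H ** J_mat = H ** (?G ** J_mat)" by (simp add: GJ)
  then show HJ: "H ** J_mat = J_mat" by (simp add: matrix_mul_assoc HG)
  show JH: "J_mat ** H = J_mat"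
    using arg_cong[OF HJ, of transpose] by (simp add: matrix_transpose_mul sH)
  have JL: "J_mat ** L = 0"
    using arg_cong[OF LJ, of transpose] L
    by (simp add: matrix_transpose_mul symmetric_mat_def) (simp add: transpose_def vec_eq_iff)
  have "L ** H = mat 1 - J_mat" "H ** L = mat 1 - J_mat"
    using H HG JH HJ by (simp_all add: matrix_mult_add_right matrix_add_ldistrib eq_diff_eq)
  then have "L ** (H - J_mat) = mat 1 - J_mat" "(H - J_mat) ** L = mat 1 - J_mat"
    by (simp_all add: matrix_mult_diff_left matrix_mult_diff_right LJ JL)
  then show "pinv L = H - J_mat"
    by (intro pinv_eqI)
      (simp add: is_pinv_def matrix_mult_diff_left matrix_mult_diff_right transpose_diff
        JL JH J_idem)
qed

section \<open>Quadratic forms of the walk matrices\<close>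

lemma transpose_left_prod:
  assumes "\<And>j. j \<le> i \<Longrightarrow> symmetric_mat (M j)"
  shows "transpose (left_prod M i) = right_prod M i"
  using assms by (induction i) (simp_all add: matrix_transpose_mul transpose_add symmetric_mat_def)

text \<open>Centering passes through each factor:
  \<open>(I - J) (I + M j) = (I + M j - J) (I - J)\<close>.\<close>

lemma right_prod_walk_prod:
  fixes M :: "nat \<Rightarrow> real ^ 'n ^ 'n"
  assumes "\<And>j. j \<le> i \<Longrightarrow> symmetric_mat (M j)" "\<And>j. j \<le> i \<Longrightarrow> M j *v (\<chi> i. 1) = (\<chi> i. 1)"
  shows "x - J_mat *v x = y \<Longrightarrow> right_prod M i *v x - J_mat *v (right_prod M i *v x)
    = walk_prod (\<lambda>i x. (M i - J_mat) *v x) i y"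
proof -
  have step: "(mat 1 + M j) *v z - J_mat *v ((mat 1 + M j) *v z)
      = (z - J_mat *v z) + (M j - J_mat) *v (z - J_mat *v z)" if "j \<le> i" for j z
    using mult_J_vec[OF assms(2)[OF that], of z] mult_J_vec[OF J_ones, of z]
      J_mult[OF assms(1,2)[OF that]]
    by (simp add: matrix_vector_mult_add_rdistrib matrix_vector_mult_diff_rdistrib
        matrix_vector_right_distrib matrix_vector_mult_diff_distrib)
      (simp add: matrix_vector_mul_assoc)
  assume y: "x - J_mat *v x = y"
  have "right_prod M j *v x - J_mat *v (right_prod M j *v x)
      = walk_prod (\<lambda>i x. (M i - J_mat) *v x) j y" if "j \<le> i" for j
    using that
  proof (induction j)
    case 0
    then show ?case using step[of 0 x] by (simp add: y)
  next
    case (Suc j)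
    then show ?case using step[of "Suc j" "right_prod M j *v x"]
      by (simp flip: matrix_vector_mul_assoc)
  qed
  then show ?thesis by simp
qed

lemma inner_centered:
  "x \<bullet> ((mat 1 - J_mat) *v x) = (x - J_mat *v x) \<bullet> (x - J_mat *v (x :: real ^ 'n))"
  using self_adjoint_inner[OF self_adjoint_matrix[OF symmetric_J], of x x]
    self_adjoint_inner[OF self_adjoint_matrix[OF symmetric_J], of x "J_mat *v x"]
    mult_J_vec[OF J_ones, of x]
  by (simp add: matrix_vector_mult_diff_rdistrib inner_simps)

text \<open>\<open>W_mat\<close> is \<open>R^T (I - J) R\<close> with
  \<open>R = right_prod M i\<close>, and \<open>I - J\<close> is an orthogonal projection, so the
  form is a squared norm.\<close>

lemma W_mat_form:
  fixes M :: "nat \<Rightarrow> real ^ 'n ^ 'n"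
  assumes "\<And>j. j \<le> i \<Longrightarrow> symmetric_mat (M j)" "\<And>j. j \<le> i \<Longrightarrow> M j *v (\<chi> i. 1) = (\<chi> i. 1)"
  shows "x \<bullet> (W_mat M i *v x)
    = walk_prod (\<lambda>i x. (M i - J_mat) *v x) i (x - J_mat *v x)
      \<bullet> walk_prod (\<lambda>i x. (M i - J_mat) *v x) i (x - J_mat *v x)"
proof -
  define y where "y = right_prod M i *v x"
  have "x \<bullet> (W_mat M i *v x) = x \<bullet> (left_prod M i *v ((mat 1 - J_mat) *v y))"
    by (simp add: W_mat_def y_def matrix_vector_mul_assoc matrix_mul_assoc)
  also have "\<dots> = y \<bullet> ((mat 1 - J_mat) *v y)"
    using inner_matrix_vector_transpose[of x "left_prod M i"] transpose_left_prod[of i M] assms(1)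
    by (simp only: y_def)
  also have "\<dots> = (y - J_mat *v y) \<bullet> (y - J_mat *v y)" by (rule inner_centered)
  finally show ?thesis
    using right_prod_walk_prod[of i M x] assms by (simp add: y_def)
qed

lemma symmetric_W_mat:
  fixes M :: "nat \<Rightarrow> real ^ 'n ^ 'n"
  assumes "\<And>j. j \<le> i \<Longrightarrow> symmetric_mat (M j)"
  shows "symmetric_mat (W_mat M i)"
proof -
  have "transpose (left_prod M i) = right_prod M i"
    using assms by (intro transpose_left_prod)
  moreover from this have "transpose (right_prod M i) = left_prod M i"
    by (metis transpose_transpose)
  ultimately show ?thesis
    by (simp add: symmetric_mat_def W_mat_def matrix_transpose_mul transpose_diff matrix_mul_assoc)
qed

section \<open>Transfer from the shifted operators to the matrices\<close>

theorem theorem4p1: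
  fixes \<epsilon> :: "nat \<Rightarrow> real" and k :: nat and M :: "nat \<Rightarrow> real ^ 'n ^ 'n"
  assumes "\<And>i. i \<le> k \<Longrightarrow> 0 \<le> \<epsilon> i"
    and "\<And>i. i \<le> k \<Longrightarrow> symmetric_mat (M i)"
    and "\<And>i. i \<le> k \<Longrightarrow> psd (mat 1 - M i)"
    and "\<And>i. 1 \<le> i \<Longrightarrow> i \<le> k \<Longrightarrow>
           approx_mat (\<epsilon> (i - 1)) (mat 1 - M i) (mat 1 - M (i - 1) ** M (i - 1))"
    and "approx_mat (\<epsilon> k) (mat 1 - M k) (mat 1 - J_mat)"
    and "M 0 *v (\<chi> i. 1) = (\<chi> i. 1)"
    and "psd (mat 1 + M 0)"
  shows "approx_mat (\<Sum>i\<le>k. \<epsilon> i) (pinv (mat 1 - M 0))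
           ((1 / 2) *\<^sub>R (mat 1 - J_mat)
            + (\<Sum>i<k. (1 / 2 ^ (i + 2)) *\<^sub>R W_mat M i)
            + (1 / 2 ^ (k + 1)) *\<^sub>R W_mat M k)"
proof -
  let ?one = "(\<chi> i. 1) :: real ^ 'n"
  let ?R = "(1 / 2) *\<^sub>R (mat 1 - J_mat) + (\<Sum>i<k. (1 / 2 ^ (i + 2)) *\<^sub>R W_mat M i)
      + (1 / 2 ^ (k + 1)) *\<^sub>R W_mat M k"
  note eps = assms(1) and sym = assms(2) and psd = assms(3) and approx = assms(4)
    and approx_k = assms(5)
  have approx': "approx_mat (\<epsilon> i) (mat 1 - M (Suc i)) (mat 1 - M i ** M i)" if "i < k" for i
    using approx[of "Suc i"] that by simp
  \<comment> \<open>If \<open>M i\<close> fixes the ones, the form of \<open>I - (M i)^2\<close>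
    vanishes there; the lower approximation and semidefiniteness then put the ones in the kernel of
    \<open>I - M (Suc i)\<close>.\<close>
  have ones: "M i *v ?one = ?one" if "i \<le> k" for i
    using that
  proof (induction i)
    case 0
    show ?case by (rule assms(6))
  next
    case (Suc i)
    then have "(mat 1 - M i ** M i) *v ?one = 0"
      by (simp add: matrix_vector_mult_diff_rdistrib flip: matrix_vector_mul_assoc)
    then have "exp (- \<epsilon> i) * (?one \<bullet> ((mat 1 - M (Suc i)) *v ?one)) \<le> 0"
      using approx_mat_form(1)[OF approx', of i ?one] Suc.prems by simp
    then have "(mat 1 - M (Suc i)) *v ?one = 0"
      using psd[of "Suc i"] Suc.prems by (intro psd_form_eq_0) (simp_all add: mult_le_0_iff)
    then show ?case by (simp add: matrix_vector_mult_diff_rdistrib)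
  qed
  define N where "N = (\<lambda>i x. (M i - J_mat) *v x)"
  have N: "self_adjoint (N i)" if "i \<le> k" for i
    using sym[OF that] unfolding N_def
    by (intro self_adjoint_matrix) (simp add: symmetric_mat_def transpose_diff)
  have J_sq: "x \<bullet> (J_mat *v x) = (J_mat *v x) \<bullet> (J_mat *v x)" for x :: "real ^ 'n"
    using self_adjoint_inner[OF self_adjoint_matrix[OF symmetric_J], of x "J_mat *v x"]
      mult_J_vec[OF J_ones, of x] by simp
  have J_nonneg: "0 \<le> x \<bullet> (J_mat *v x)" for x :: "real ^ 'n"
    unfolding J_sq by simp
  have L: "x \<bullet> (x - N i x) = x \<bullet> ((mat 1 - M i) *v x) + x \<bullet> (J_mat *v x)" for x i
    by (simp add: N_def matrix_vector_mult_diff_rdistrib inner_simps)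
  have A: "x \<bullet> (x - N i (N i x)) = x \<bullet> ((mat 1 - M i ** M i) *v x) + x \<bullet> (J_mat *v x)"
    if "i \<le> k" for x i
  proof -
    have "(M i - J_mat) ** (M i - J_mat) = M i ** M i - J_mat"
      using mult_J[OF ones[OF that]] J_mult[OF sym[OF that] ones[OF that]]
      by (simp add: matrix_mult_diff_left matrix_mult_diff_right J_idem)
    then have "N i (N i x) = (M i ** M i - J_mat) *v x"
      by (simp only: N_def matrix_vector_mul_assoc)
    then show ?thesis by (simp add: matrix_vector_mult_diff_rdistrib inner_simps)
  qed
  \<comment> \<open>Replacing \<open>M\<close> by \<open>N\<close> adds \<open>J\<close> to both
    sides of every comparison, and \<open>J\<close> approximates itself with any nonnegative
    error.\<close>
  have shrink: "exp (- \<epsilon> i) * (x \<bullet> (J_mat *v x)) \<le> x \<bullet> (J_mat *v x)"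
    and grow: "x \<bullet> (J_mat *v x) \<le> exp (\<epsilon> i) * (x \<bullet> (J_mat *v x))" if "i \<le> k" for i and x :: "real ^ 'n"
    using J_nonneg[of x] eps[OF that] by (simp_all add: mult_le_cancel_right1 mult_le_cancel_right2)
  have I: "x \<bullet> x = x \<bullet> ((mat 1 - J_mat) *v x) + x \<bullet> (J_mat *v x)" for x :: "real ^ 'n"
    by (simp add: matrix_vector_mult_diff_rdistrib inner_simps)
  have lo: "exp (- \<epsilon> i) * (x \<bullet> (x - N (Suc i) x)) \<le> x \<bullet> (x - N i (N i x))" if "i < k" for i x
    using approx_mat_form(1)[OF approx'[OF that], of x] shrink[OF less_imp_le[OF that], of x]
    by (simp only: L A[OF less_imp_le[OF that]] distrib_left)
  have up: "x \<bullet> (x - N i (N i x)) \<le> exp (\<epsilon> i) * (x \<bullet> (x - N (Suc i) x))" if "i < k" for i x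
    using approx_mat_form(2)[OF approx'[OF that], of x] grow[OF less_imp_le[OF that], of x]
    by (simp only: L A[OF less_imp_le[OF that]] distrib_left)
  have lo_k: "exp (- \<epsilon> k) * (x \<bullet> (x - N k x)) \<le> x \<bullet> x" for x
    using approx_mat_form(1)[OF approx_k, of x] shrink[OF order.refl, of x]
    by (simp only: L I[of x] distrib_left)
  have up_k: "x \<bullet> x \<le> exp (\<epsilon> k) * (x \<bullet> (x - N k x))" for x
    using approx_mat_form(2)[OF approx_k, of x] grow[OF order.refl, of x]
    by (simp only: L I[of x] distrib_left)
  have "surj (\<lambda>x. x - N 0 x)"
    by (intro positive_definite_surj sandwich_positive_definite[of k N \<epsilon>]
        self_adjoint_linear[OF self_adjoint_id_minus] N lo up_k) simp_all
  then have "surj ((*v) (mat 1 - M 0 + J_mat))"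
    by (simp add: diff_diff_eq2 diff_add_eq N_def matrix_vector_mult_diff_rdistrib matrix_vector_mult_add_rdistrib)
  then obtain H where H: "(mat 1 - M 0 + J_mat) ** H = mat 1"
    using matrix_right_invertible_surjective by blast
  have sym_L: "symmetric_mat (mat 1 - M 0)" using psd[of 0] by (simp add: psd_def)
  have LJ: "(mat 1 - M 0) ** J_mat = 0"
    using mult_J[OF ones[of 0]] by (simp add: matrix_mult_diff_right)
  note pinv = pinv_eq_inverse_minus_J[OF sym_L LJ H]
  have form_R: "x \<bullet> (?R *v x) = walk_form N k (x - J_mat *v x)" for x
  proof -
    have W: "x \<bullet> (W_mat M i *v x)
        = walk_prod N i (x - J_mat *v x) \<bullet> walk_prod N i (x - J_mat *v x)" if "i \<le> k" for i
      unfolding N_def using that sym ones by (intro W_mat_form) auto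
    show ?thesis
      by (simp add: matrix_vector_mult_add_rdistrib sum_matrix_vector_mult inner_add_right
          inner_sum_right W inner_centered walk_form_def flip: scaleR_matrix_vector_assoc)
  qed
  \<comment> \<open>The witness \<open>w\<close> turns out to be the pseudoinverse applied to
    \<open>x\<close>. It is orthogonal to the ones, so pairing it with \<open>x\<close> or with the
    centered part of \<open>x\<close> gives the same value.\<close>
  have form_pinv: "\<exists>w. w - N 0 w = x - J_mat *v x
      \<and> x \<bullet> (pinv (mat 1 - M 0) *v x) = w \<bullet> (w - N 0 w)" for x
  proof (intro exI conjI)
    define w where "w = H *v (x - J_mat *v x)"
    have "w - N 0 w = (mat 1 - M 0 + J_mat) *v w"
      by (simp add: N_def matrix_vector_mult_diff_rdistrib matrix_vector_mult_add_rdistrib)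
    then show Lw: "w - N 0 w = x - J_mat *v x"
      by (simp add: w_def matrix_vector_mul_assoc H)
    have w: "w = pinv (mat 1 - M 0) *v x"
      by (simp add: w_def pinv matrix_vector_mult_diff_distrib matrix_vector_mult_diff_rdistrib
          matrix_vector_mul_assoc)
    have "J_mat *v w = 0"
      by (simp add: w pinv matrix_vector_mul_assoc matrix_mult_diff_left J_idem)
    then show "x \<bullet> (pinv (mat 1 - M 0) *v x) = w \<bullet> (w - N 0 w)"
      using self_adjoint_inner[OF self_adjoint_matrix[OF symmetric_J], of w x]
      by (simp add: Lw inner_simps inner_commute flip: w)
  qed
  have psd_0: "0 \<le> x \<bullet> (x + N 0 x)" if "k = 0" for x
  proof -
    \<comment> \<open>Split into the centered part and the ones: \<open>I + M 0\<close> has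
      eigenvalue \<open>2\<close> on the ones, where \<open>I + N 0\<close> has
      \<open>1\<close>.\<close>
    have "x \<bullet> (x + N 0 x) = (x - J_mat *v x) \<bullet> ((mat 1 + M 0) *v (x - J_mat *v x))
        + x \<bullet> (J_mat *v x)"
    proof -
      define j where "j = J_mat *v x"
      have "M 0 *v j = j" unfolding j_def using ones[of 0] by (intro mult_J_vec) simp
      moreover have "j \<bullet> (M 0 *v x) = (M 0 *v j) \<bullet> x"
        using self_adjoint_inner[OF self_adjoint_matrix[OF sym[of 0]]] by simp
      moreover have "x \<bullet> j = j \<bullet> j" using J_sq[of x] by (simp add: j_def)
      ultimately show ?thesis
        unfolding N_def matrix_vector_mult_diff_rdistrib matrix_vector_mult_add_rdistrib
          matrix_vector_mult_diff_distrib j_def[symmetric] inner_simps matrix_vector_mul_lid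
        by (simp add: inner_commute)
    qed
    then show ?thesis using assms(7) J_nonneg[of x] by (simp add: psd_def)
  qed
  have bounds: "exp (- (\<Sum>i\<le>k. \<epsilon> i)) * (w \<bullet> (w - N 0 w)) \<le> walk_form N k (w - N 0 w)
      \<and> walk_form N k (w - N 0 w) \<le> exp (\<Sum>i\<le>k. \<epsilon> i) * (w \<bullet> (w - N 0 w))" for w
    by (intro walk_form_approx eps N lo up lo_k up_k psd_0)
  show ?thesis
  proof (rule approx_matI)
    show "symmetric_mat (pinv (mat 1 - M 0))"
      using pinv(2) by (simp add: pinv(1) symmetric_mat_def transpose_diff)
    have "symmetric_mat (W_mat M i)" if "i \<le> k" for i
      using that sym by (intro symmetric_W_mat) auto
    then show "symmetric_mat ?R"
      by (simp add: symmetric_mat_def transpose_add transpose_sum transpose_scalar transpose_diff)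
    fix x :: "real ^ 'n"
    obtain w where w: "w - N 0 w = x - J_mat *v x"
        "x \<bullet> (pinv (mat 1 - M 0) *v x) = w \<bullet> (w - N 0 w)"
      using form_pinv by blast
    show "exp (- (\<Sum>i\<le>k. \<epsilon> i)) * (x \<bullet> (pinv (mat 1 - M 0) *v x)) \<le> x \<bullet> (?R *v x)"
      and "x \<bullet> (?R *v x) \<le> exp (\<Sum>i\<le>k. \<epsilon> i) * (x \<bullet> (pinv (mat 1 - M 0) *v x))"
      unfolding form_R w(2) using bounds[of w] by (simp_all add: w(1))
  qed
qed

end
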